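(* Let $F_n$ be a free group of rank $n$ and let $w\in F_n$. 1. If $w$ is achiral, then $\sigma(w)$ is achiral for all $\sigma\in \mathrm{Aut}(F_n)$. 2. If $w$ is achiral, then $w^k$ is achiral for all $k\in\mathbb{Z}$. 3. If $w^k$ is achiral for some $k\in\mathbb{Z}\setminus\{0\}$, then $w$ is achiral.
   Context: Let $F_n$ be the free group on $x_1,\ldots,x_n$. For $w\in F_n$ and a group $G$, the word map of $w$ on $G$ is the map $G^n\to G$, $(g_1,\ldots,g_n)\mapsto w(g_1,\ldots,g_n)$, obtained by substituting $g_i$ for $x_i$ in $w$; its image is denoted $G_w$. A word $w\in F_n$ is achiral if $G_w=G_{w^{-1}}$ for every group $G$. *)

theory Defs
  imports "HOL-Algebra.Algebra" "HOL-Library.Countable_Set"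
begin

section \<open>The free group of rank n\<close>

text \<open>
  The library has no free groups, so the usual model is used: the elements are the reduced words,
  and the product is concatenation followed by free reduction.
  The letter \<open>(i, True)\<close> stands for the generator \<open>x\<^sub>i\<close>, and \<open>(i, False)\<close> for its inverse.
  The generators are numbered from 0, i.e. \<open>x\<^sub>0, \<dots>, x\<^sub>n\<^sub>-\<^sub>1\<close>.
\<close>

type_synonym letter = "nat \<times> bool"
type_synonym word = "letter list"

definition inv_letter :: "letter \<Rightarrow> letter" where
  "inv_letter x = (fst x, \<not> snd x)"

definition reduced :: "word \<Rightarrow> bool" where
  "reduced = successively (\<lambda>x y. y \<noteq> inv_letter x)"

fun push :: "letter \<Rightarrow> word \<Rightarrow> word" where
  "push x [] = [x]"
| "push x (y # ys) = (if y = inv_letter x then ys else x # y # ys)"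

definition reduce :: "word \<Rightarrow> word" where
  "reduce w = foldr push w []"

definition free_group :: "nat \<Rightarrow> word monoid" where
  "free_group n =
     \<lparr>carrier = {w \<in> lists ({..<n} \<times> UNIV). reduced w},
      monoid.mult = (\<lambda>u v. reduce (u @ v)),
      one = []\<rparr>"

definition gen :: "nat \<Rightarrow> word" where
  "gen i = [(i, True)]"


section \<open>Word maps and achiral words\<close>

fun word_eval :: "('g, 'm) monoid_scheme \<Rightarrow> (nat \<Rightarrow> 'g) \<Rightarrow> word \<Rightarrow> 'g" where
  "word_eval G g [] = \<one>\<^bsub>G\<^esub>"
| "word_eval G g (x # xs) =
     (if snd x then g (fst x) else inv\<^bsub>G\<^esub> (g (fst x))) \<otimes>\<^bsub>G\<^esub> word_eval G g xs"

definition word_map :: "nat \<Rightarrow> word \<Rightarrow> ('g, 'm) monoid_scheme \<Rightarrow> (nat \<Rightarrow> 'g) \<Rightarrow> 'g" where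
  "word_map n w G = (\<lambda>g \<in> {..<n} \<rightarrow>\<^sub>E carrier G. word_eval G g w)"

definition word_image :: "nat \<Rightarrow> word \<Rightarrow> ('g, 'm) monoid_scheme \<Rightarrow> 'g set" where
  "word_image n w G = word_map n w G ` ({..<n} \<rightarrow>\<^sub>E carrier G)"

text \<open>
  HOL cannot quantify over types inside a formula, so the type of the group elements is a
  parameter: \<open>achiral TYPE('g) n w\<close> ranges over all groups with elements in \<open>'g\<close>.
  Achirality in the usual sense is \<open>achiral TYPE('g) n w\<close> for every type \<open>'g\<close>. By the lemma
  \<open>achiral_transfer\<close> below this already follows from the instance of any one infinite type,
  in particular of \<^typ>\<open>nat\<close>; no finite type suffices for all words.
\<close>

definition achiral :: "'g itself \<Rightarrow> nat \<Rightarrow> word \<Rightarrow> bool" where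
  "achiral _ n w \<longleftrightarrow>
     (\<forall>G :: 'g monoid. group G \<longrightarrow> word_image n w G = word_image n (inv\<^bsub>free_group n\<^esub> w) G)"


section \<open>The model is a free group\<close>

lemma inv_letter_inv_letter [simp]: "inv_letter (inv_letter x) = x"
  by (simp add: inv_letter_def)

lemma reduced_Nil [simp]: "reduced []"
  by (simp add: reduced_def)

lemma reduced_Cons: "reduced (x # w) \<longleftrightarrow> (w = [] \<or> hd w \<noteq> inv_letter x) \<and> reduced w"
  by (auto simp: reduced_def successively_Cons)

lemma reduced_push: "reduced w \<Longrightarrow> reduced (push x w)"
  by (cases w) (auto simp: reduced_Cons)

lemma reduced_foldr_push: "reduced v \<Longrightarrow> reduced (foldr push u v)"
  by (induction u) (auto simp: reduced_push)

lemma reduced_reduce: "reduced (reduce w)"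
  by (simp add: reduce_def reduced_foldr_push)

lemma push_reduced: "reduced (x # w) \<Longrightarrow> push x w = x # w"
  by (cases w) (auto simp: reduced_Cons)

lemma reduce_reduced: "reduced w \<Longrightarrow> reduce w = w"
  by (induction w) (auto simp: reduce_def reduced_Cons push_reduced)

lemma push_push_inv_letter: "reduced w \<Longrightarrow> push x (push (inv_letter x) w) = w"
  by (cases w rule: remdups_adj.cases) (auto simp: reduced_Cons)

lemma foldr_push_push:
  "reduced v \<Longrightarrow> foldr push (push x u) v = push x (foldr push u v)"
  using push_push_inv_letter[of _ x] by (cases u) (auto simp: reduced_foldr_push)

lemma foldr_push_foldr_push:
  "reduced w \<Longrightarrow> foldr push (foldr push u v) w = foldr push u (foldr push v w)"
  by (induction u) (auto simp: foldr_push_push)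

lemma reduce_append: "reduced v \<Longrightarrow> reduce (u @ v) = foldr push u v"
  using reduce_reduced[of v] by (simp add: reduce_def)

lemma push_in_lists: "x \<in> A \<Longrightarrow> w \<in> lists A \<Longrightarrow> push x w \<in> lists A"
  by (cases w) auto

lemma foldr_push_in_lists: "u \<in> lists A \<Longrightarrow> v \<in> lists A \<Longrightarrow> foldr push u v \<in> lists A"
  by (induction u) (auto simp: push_in_lists simp del: in_lists_conv_set)

lemma foldr_push_inverse:
  "foldr push (map inv_letter (rev w)) w = []"
proof (induction w)
  case (Cons x w)
  then show ?case by simp
qed simp

lemma foldr_push_inverse':
  "reduced v \<Longrightarrow> foldr push (map inv_letter (rev w)) (foldr push w v) = v"
proof (induction w)
  case (Cons x w)
  then show ?case
    using push_push_inv_letter[of "foldr push w v" "inv_letter x"]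
    by (simp add: reduced_foldr_push)
qed simp

lemma group_free_group: "group (free_group n)"
proof (rule groupI)
  let ?L = "{..<n} \<times> (UNIV :: bool set)"
  fix x assume x: "x \<in> carrier (free_group n)"
  let ?y = "reduce (map inv_letter (rev x))"
  have "map inv_letter (rev x) \<in> lists ?L"
    using x by (fastforce simp: free_group_def inv_letter_def)
  then have "?y \<in> carrier (free_group n)"
    using foldr_push_in_lists[of "map inv_letter (rev x)" ?L "[]"]
    by (simp add: free_group_def reduced_reduce reduce_def reduced_foldr_push)
  moreover have "?y \<otimes>\<^bsub>free_group n\<^esub> x = \<one>\<^bsub>free_group n\<^esub>"
    using x by (simp add: free_group_def reduce_append)
      (simp add: reduce_def foldr_push_foldr_push foldr_push_inverse)
  ultimately show "\<exists>y\<in>carrier (free_group n). y \<otimes>\<^bsub>free_group n\<^esub> x = \<one>\<^bsub>free_group n\<^esub>"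
    by blast
next
  fix x y assume "x \<in> carrier (free_group n)" "y \<in> carrier (free_group n)"
  then show "x \<otimes>\<^bsub>free_group n\<^esub> y \<in> carrier (free_group n)"
    using foldr_push_in_lists[of x _ y]
    by (simp add: free_group_def reduce_append reduced_foldr_push del: in_lists_conv_set)
next
  fix x y z
  assume "x \<in> carrier (free_group n)" "y \<in> carrier (free_group n)" "z \<in> carrier (free_group n)"
  then show "x \<otimes>\<^bsub>free_group n\<^esub> y \<otimes>\<^bsub>free_group n\<^esub> z = x \<otimes>\<^bsub>free_group n\<^esub> (y \<otimes>\<^bsub>free_group n\<^esub> z)"
    by (simp add: free_group_def reduce_append reduced_foldr_push foldr_push_foldr_push)
qed (auto simp: free_group_def reduce_reduced)

lemma gen_in_carrier: "i < n \<Longrightarrow> gen i \<in> carrier (free_group n)"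
  by (simp add: gen_def free_group_def reduced_Cons)

lemma inv_gen: "i < n \<Longrightarrow> inv\<^bsub>free_group n\<^esub> gen i = [(i, False)]"
proof -
  assume i: "i < n"
  interpret F: group "free_group n" by (rule group_free_group)
  have "[(i, False)] \<in> carrier (free_group n)" "[(i, False)] \<otimes>\<^bsub>free_group n\<^esub> gen i = \<one>\<^bsub>free_group n\<^esub>"
    using i by (auto simp: gen_def free_group_def reduced_Cons reduce_def inv_letter_def)
  with i show ?thesis
    using F.inv_equality gen_in_carrier by blast
qed

lemma (in group) word_eval_closed:
  assumes "g \<in> {..<n} \<rightarrow> carrier G" "w \<in> lists ({..<n} \<times> UNIV)"
  shows "word_eval G g w \<in> carrier G"
  using assms(2,1) by (induction w) (auto simp: Pi_iff)

lemma (in group) word_eval_push: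
  assumes g: "g \<in> {..<n} \<rightarrow> carrier G" and x: "x \<in> {..<n} \<times> UNIV"
    and w: "w \<in> lists ({..<n} \<times> UNIV)"
  shows "word_eval G g (push x w) = word_eval G g (x # w)"
proof (cases w)
  case (Cons y ys)
  have gx: "g (fst x) \<in> carrier G" using g x by auto
  have ys: "word_eval G g ys \<in> carrier G" using word_eval_closed[OF g] w Cons by auto
  show ?thesis
    using gx ys Cons by (auto simp: inv_letter_def inv_solve_left m_assoc[symmetric])
qed simp

lemma (in group) word_eval_foldr_push:
  assumes g: "g \<in> {..<n} \<rightarrow> carrier G" and u: "u \<in> lists ({..<n} \<times> UNIV)"
    and v: "v \<in> lists ({..<n} \<times> UNIV)"
  shows "word_eval G g (foldr push u v) = word_eval G g u \<otimes> word_eval G g v"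
  using u
proof (induction u)
  case Nil
  then show ?case using word_eval_closed[OF g v] by simp
next
  case (Cons x u)
  have "word_eval G g (push x (foldr push u v)) = word_eval G g (x # foldr push u v)"
    using Cons foldr_push_in_lists[of u "{..<n} \<times> UNIV" v] v by (intro word_eval_push[OF g]) auto
  moreover have "g (fst x) \<in> carrier G" using g Cons by auto
  ultimately show ?case
    using Cons word_eval_closed[OF g] v by (auto simp: m_assoc)
qed

text \<open>
  The universal property: the assignment \<open>x\<^sub>i \<mapsto> g i\<close> extends uniquely to a homomorphism, namely
  to the evaluation of words.
\<close>

lemma (in group) word_eval_hom:
  assumes g: "g \<in> {..<n} \<rightarrow> carrier G"
  shows "word_eval G g \<in> hom (free_group n) G"
proof (rule homI)
  fix x y assume "x \<in> carrier (free_group n)" "y \<in> carrier (free_group n)"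
  then show "word_eval G g (x \<otimes>\<^bsub>free_group n\<^esub> y) = word_eval G g x \<otimes> word_eval G g y"
    using word_eval_foldr_push[OF g] by (simp add: free_group_def reduce_append)
qed (use word_eval_closed[OF g] in \<open>auto simp: free_group_def\<close>)

lemma (in group) word_eval_gen:
  "g \<in> {..<n} \<rightarrow> carrier G \<Longrightarrow> i < n \<Longrightarrow> word_eval G g (gen i) = g i"
  by (auto simp: gen_def Pi_iff)

lemma (in group) hom_eq_word_eval:
  assumes h: "h \<in> hom (free_group n) G" and w: "w \<in> carrier (free_group n)"
  shows "h w = word_eval G (\<lambda>i. h (gen i)) w"
proof -
  interpret group_hom "free_group n" G h
    using h group_free_group is_group by (simp add: group_hom_def group_hom_axioms_def)
  show ?thesis using w
  proof (induction w)
    case Nil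
    then show ?case using hom_one by (simp add: free_group_def)
  next
    case (Cons x w)
    have w: "w \<in> carrier (free_group n)" and x: "fst x < n" "[x] \<in> carrier (free_group n)"
      using Cons.prems by (auto simp: free_group_def reduced_Cons)
    have "[x] \<otimes>\<^bsub>free_group n\<^esub> w = x # w"
      using Cons.prems by (simp add: free_group_def reduce_reduced)
    then have "h (x # w) = h [x] \<otimes> h w"
      using hom_mult[OF x(2) w] by simp
    moreover have "h [x] = (if snd x then h (gen (fst x)) else inv (h (gen (fst x))))"
    proof (cases "snd x")
      case True
      then show ?thesis by (cases x) (simp add: gen_def)
    next
      case False
      then have "[x] = inv\<^bsub>free_group n\<^esub> gen (fst x)"
        using inv_gen[OF x(1)] by (cases x) simp
      then show ?thesis
        using False hom_inv gen_in_carrier[OF x(1)] by simp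
    qed
    ultimately show ?case using Cons.IH[OF w] by simp
  qed
qed


section \<open>One infinite type suffices\<close>

lemma word_eval_cong:
  "(\<And>i. i < n \<Longrightarrow> g i = h i) \<Longrightarrow> w \<in> lists ({..<n} \<times> UNIV) \<Longrightarrow> word_eval G g w = word_eval G h w"
  by (induction w) auto

lemma word_image_eq:
  assumes "w \<in> carrier (free_group n)"
  shows "word_image n w G = {word_eval G g w |g. g \<in> {..<n} \<rightarrow> carrier G}"
proof -
  have "word_eval G g w \<in> word_image n w G" if "g \<in> {..<n} \<rightarrow> carrier G" for g
  proof -
    have "word_eval G g w = word_eval G (restrict g {..<n}) w"
      using assms by (intro word_eval_cong[of n]) (auto simp: free_group_def)
    moreover have "restrict g {..<n} \<in> {..<n} \<rightarrow>\<^sub>E carrier G"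
      using that by auto
    ultimately show ?thesis
      unfolding word_image_def word_map_def by (metis (no_types, lifting) imageI restrict_apply')
  qed
  then show ?thesis
    by (auto simp: word_image_def word_map_def)
qed

lemma hom_word_eval:
  assumes G: "group G" and H: "group H" and h: "h \<in> hom G H"
    and g: "g \<in> {..<n} \<rightarrow> carrier G" and w: "w \<in> lists ({..<n} \<times> UNIV)"
  shows "h (word_eval G g w) = word_eval H (\<lambda>i. h (g i)) w"
proof -
  interpret group_hom G H h
    using assms by (simp add: group_hom_def group_hom_axioms_def)
  show ?thesis using w
  proof (induction w)
    case (Cons x w)
    have "g (fst x) \<in> carrier G" using g Cons by auto
    moreover have "word_eval G g w \<in> carrier G"
      using G.word_eval_closed[OF g] Cons by auto
    ultimately show ?case using Cons by auto
  qed simp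
qed

lemma achiral_transfer:
  assumes inf: "infinite (UNIV :: 'h set)"
    and w: "w \<in> carrier (free_group n)" and ach: "achiral TYPE('h) n w"
  shows "achiral TYPE('g) n w"
proof -
  let ?F = "free_group n"
  interpret F: group ?F by (rule group_free_group)
  have key: "word_image n u G \<subseteq> word_image n v G"
    if G: "group G" and u: "u \<in> carrier ?F" and v: "v \<in> carrier ?F"
      and uv: "\<And>H :: 'h monoid. group H \<Longrightarrow> word_image n u H = word_image n v H"
    for G :: "'g monoid" and u v
  proof
    interpret G: group G by (rule G)
    fix a assume "a \<in> word_image n u G"
    then obtain g where g: "g \<in> {..<n} \<rightarrow> carrier G" and a: "a = word_eval G g u"
      using u by (auto simp: word_image_eq)
    define S where "S = word_eval G g ` carrier ?F"
    have hom: "group_hom ?F G (word_eval G g)"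
      using G.word_eval_hom[OF g] G group_free_group
      by (simp add: group_hom_def group_hom_axioms_def)
    have sub: "subgroup S G"
      unfolding S_def by (rule group_hom.img_is_subgroup[OF hom])
    let ?S = "G\<lparr>carrier := S\<rparr>"
    have grS: "group ?S" by (rule G.subgroup_imp_group[OF sub])
    have "countable S" unfolding S_def by simp
    moreover obtain e :: "nat \<Rightarrow> 'h" where "inj e"
      using infinite_countable_subset[OF inf] by blast
    ultimately have inj: "inj_on (e \<circ> to_nat_on S) S"
      by (meson comp_inj_on inj_on_subset inj_on_to_nat_on subset_UNIV)
    define f where "f = e \<circ> to_nat_on S"
    define H where "H = image_group f ?S"
    have injf: "inj_on f (carrier ?S)" using inj by (simp add: f_def)
    have iso: "f \<in> iso ?S H"
      unfolding H_def using injf by (rule inj_imp_image_group_iso)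
    have grH: "group H"
      unfolding H_def using injf by (rule group.inj_imp_image_group_is_group[OF grS])
    define f' where "f' = inv_into S f"
    have iso': "f' \<in> hom H ?S"
      using group.iso_set_sym[OF grS iso] by (simp add: f'_def iso_def)
    have incl: "(\<lambda>x. x) \<in> hom ?S G"
      using subgroup.subset[OF sub] by (auto simp: hom_def)
    have gS: "g \<in> {..<n} \<rightarrow> S"
      using G.word_eval_gen[OF g] gen_in_carrier[of _ n]
      unfolding S_def by (metis (no_types, lifting) Pi_I image_eqI lessThan_iff)
    have lists: "u \<in> lists ({..<n} \<times> UNIV)" "v \<in> lists ({..<n} \<times> UNIV)"
      using u v by (auto simp: free_group_def)
    have eqS: "word_eval ?S g u = a"
      using hom_word_eval[OF grS G incl _ lists(1), of g] gS a by simp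
    have fg: "(\<lambda>i. f (g i)) \<in> {..<n} \<rightarrow> carrier H"
      using gS iso by (auto simp: iso_def hom_def)
    have "f a = word_eval H (\<lambda>i. f (g i)) u"
      using hom_word_eval[OF grS grH _ _ lists(1), of f g] iso gS eqS by (simp add: iso_def)
    then have "f a \<in> word_image n u H" using fg u by (auto simp: word_image_eq)
    then have "f a \<in> word_image n v H" using uv[OF grH] by simp
    then obtain h where h: "h \<in> {..<n} \<rightarrow> carrier H" and fa: "f a = word_eval H h v"
      using v by (auto simp: word_image_eq)
    have f'h: "(\<lambda>i. f' (h i)) \<in> {..<n} \<rightarrow> S"
      using h iso' by (auto simp: hom_def)
    have "a \<in> S" using u a by (simp add: S_def)
    then have "a = f' (f a)" using injf by (simp add: f'_def)
    also have "\<dots> = word_eval ?S (\<lambda>i. f' (h i)) v"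
      unfolding fa using hom_word_eval[OF grH grS iso' h lists(2)] .
    also have "\<dots> = word_eval G (\<lambda>i. f' (h i)) v"
      using hom_word_eval[OF grS G incl _ lists(2)] f'h by simp
    finally show "a \<in> word_image n v G"
      using v f'h subgroup.subset[OF sub] by (auto simp: word_image_eq)
  qed
  have iw: "inv\<^bsub>?F\<^esub> w \<in> carrier ?F" using w by simp
  show ?thesis
    using key[OF _ w iw] key[OF _ iw w] ach unfolding achiral_def by blast
qed

end

theory Submission
  imports Defs
begin

text \<open>
  Achirality is decided inside the free group \<open>F\<close> itself: \<open>w\<close> is achiral iff some endomorphism
  \<open>\<phi>\<close> of \<open>F\<close> sends \<open>w\<close> to its inverse. If \<open>w\<close> is achiral, look at the group \<open>G = F\<close>, to which
  the assumption about groups on \<open>nat\<close> transfers: there \<open>w\<inverse>\<close> is a value of its own word map,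
  hence also a value of the word map of \<open>w\<close>, and substituting words for generators is applying an
  endomorphism (\<open>inverting_endomorphism_if_achiral\<close>). Conversely, if an endomorphism takes \<open>u\<close> to
  \<open>v\<close>, every value of \<open>v\<close> in any group is a value of \<open>u\<close>; an endomorphism that sends \<open>w\<close> to \<open>w\<inverse>\<close>
  also sends \<open>w\<inverse>\<close> to \<open>w\<close>, so it gives both inclusions (\<open>achiral_if_inverting_endomorphism\<close>).

  With this criterion, the first two claims are formal: \<open>\<sigma> \<circ> \<phi> \<circ> \<sigma>\<inverse>\<close> inverts \<open>\<sigma> w\<close>, and \<open>\<phi>\<close> itself
  inverts \<open>w\<^sup>k\<close>. For the third, \<open>\<phi>\<close> inverting \<open>w\<^sup>k\<close> means \<open>(\<phi> w)\<^sup>k = (w\<inverse>)\<^sup>k\<close>, and it remains to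
  know that roots of nonzero exponent in a free group are unique (\<open>free_group_int_pow_inj\<close>). This holds because a reduced
  word factors as \<open>u c u\<inverse>\<close> with \<open>c\<close> cyclically reduced, its positive powers are the
  words \<open>u c\<^sup>k u\<inverse>\<close>, already reduced as written, and from such a word \<open>u\<close> and \<open>c\<^sup>k\<close> can be read off,
  hence also \<open>c\<close>.
\<close>

section \<open>Achirality as the existence of an inverting endomorphism\<close>

text \<open>
  An assignment \<open>x\<^sub>i \<mapsto> g i\<close> evaluates \<open>\<phi> u\<close> to the same element as the assignment
  \<open>x\<^sub>i \<mapsto> (value of \<phi> x\<^sub>i)\<close> evaluates \<open>u\<close>, since both are homomorphisms that agree on generators.
\<close>

lemma word_image_endomorphism_subset:
  assumes G: "group G" and \<phi>: "\<phi> \<in> hom (free_group n) (free_group n)"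
    and u: "u \<in> carrier (free_group n)"
  shows "word_image n (\<phi> u) G \<subseteq> word_image n u G"
proof
  interpret G: group G by (rule G)
  have \<phi>u: "\<phi> u \<in> carrier (free_group n)"
    using \<phi> u by (rule hom_in_carrier)
  fix a assume "a \<in> word_image n (\<phi> u) G"
  then obtain g where g: "g \<in> {..<n} \<rightarrow> carrier G" and a: "a = word_eval G g (\<phi> u)"
    by (auto simp: word_image_eq[OF \<phi>u])
  have h: "word_eval G g \<circ> \<phi> \<in> hom (free_group n) G"
    using \<phi> G.word_eval_hom[OF g] by (rule hom_compose)
  have "a = word_eval G (\<lambda>i. (word_eval G g \<circ> \<phi>) (gen i)) u"
    using G.hom_eq_word_eval[OF h u] a by simp
  moreover have "(\<lambda>i. (word_eval G g \<circ> \<phi>) (gen i)) \<in> {..<n} \<rightarrow> carrier G"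
    using hom_in_carrier[OF h] gen_in_carrier by auto
  ultimately show "a \<in> word_image n u G"
    unfolding word_image_eq[OF u] by blast
qed

lemma hom_inv_free_group:
  assumes "\<phi> \<in> hom (free_group n) (free_group m)" "w \<in> carrier (free_group n)"
  shows "\<phi> (inv\<^bsub>free_group n\<^esub> w) = inv\<^bsub>free_group m\<^esub> \<phi> w"
  using assms group_hom.hom_inv[of "free_group n" "free_group m"] group_free_group
  by (simp add: group_hom_def group_hom_axioms_def)

lemma achiral_if_inverting_endomorphism:
  assumes w: "w \<in> carrier (free_group n)" and \<phi>: "\<phi> \<in> hom (free_group n) (free_group n)"
    and inv: "\<phi> w = inv\<^bsub>free_group n\<^esub> w"
  shows "achiral TYPE('g) n w"
proof -
  interpret F: group "free_group n" by (rule group_free_group)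
  have swap: "\<phi> (inv\<^bsub>free_group n\<^esub> w) = w"
    using hom_inv_free_group[OF \<phi> w] inv w by simp
  show ?thesis
    unfolding achiral_def
    using word_image_endomorphism_subset[OF _ \<phi> w]
      word_image_endomorphism_subset[OF _ \<phi> F.inv_closed[OF w]]
    unfolding inv swap by blast
qed

lemma inverting_endomorphism_if_achiral:
  assumes inf: "infinite (UNIV :: 'h set)"
    and w: "w \<in> carrier (free_group n)" and ach: "achiral TYPE('h) n w"
  obtains \<phi> where "\<phi> \<in> hom (free_group n) (free_group n)" "\<phi> w = inv\<^bsub>free_group n\<^esub> w"
proof -
  let ?F = "free_group n"
  interpret F: group ?F by (rule group_free_group)
  have iw: "inv\<^bsub>?F\<^esub> w \<in> carrier ?F" using w by simp
  have id: "(\<lambda>x. x) \<in> hom ?F ?F" by (auto simp: hom_def)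
  \<comment> \<open>Under the tautological assignment \<open>x\<^sub>i \<mapsto> x\<^sub>i\<close> every element of \<open>F\<close> is its own value.\<close>
  have "word_eval ?F gen (inv\<^bsub>?F\<^esub> w) = inv\<^bsub>?F\<^esub> w"
    by (rule F.hom_eq_word_eval[OF id iw, symmetric])
  then have "inv\<^bsub>?F\<^esub> w \<in> word_image n (inv\<^bsub>?F\<^esub> w) ?F"
    unfolding word_image_eq[OF iw] using gen_in_carrier
    by (metis (mono_tags, lifting) Pi_I lessThan_iff mem_Collect_eq)
  also have "\<dots> = word_image n w ?F"
    using achiral_transfer[OF inf w ach, where 'g = word] group_free_group
    unfolding achiral_def by blast
  finally obtain g where g: "g \<in> {..<n} \<rightarrow> carrier ?F" and "word_eval ?F g w = inv\<^bsub>?F\<^esub> w"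
    unfolding word_image_eq[OF w] by auto
  then show ?thesis
    using that F.word_eval_hom[OF g] by blast
qed


section \<open>Uniqueness of roots in a free group\<close>

abbreviation inverse_word :: "word \<Rightarrow> word" where
  "inverse_word u \<equiv> map inv_letter (rev u)"

abbreviation word_power :: "word \<Rightarrow> nat \<Rightarrow> word" where
  "word_power c k \<equiv> concat (replicate k c)"

lemma reduced_append:
  "reduced (u @ v) \<longleftrightarrow>
     reduced u \<and> reduced v \<and> (u = [] \<or> v = [] \<or> hd v \<noteq> inv_letter (last u))"
  by (auto simp: reduced_def successively_append_iff)

lemma word_power_Suc_right: "word_power c (Suc k) = word_power c k @ c"
  by (induction k) auto

lemma word_power_inj:
  assumes "k > 0" "word_power c k = word_power d k"
  shows "c = d"
proof -
  obtain m where k: "k = Suc m" using assms(1) by (cases k) auto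
  have "k * length c = k * length d"
    using arg_cong[OF assms(2), of length] by (simp add: length_concat sum_list_replicate)
  then have "length c = length d" using assms(1) by simp
  then show ?thesis using assms(2) by (simp add: k)
qed

text \<open>
  Being cyclically reduced is expressed by \<open>reduced (c @ c)\<close>, which also covers the empty word.
\<close>

lemma cyclically_reduced_core:
  assumes "reduced w"
  obtains u c where "w = u @ c @ inverse_word u" "reduced (c @ c)"
proof -
  have "\<exists>u c. w = u @ c @ inverse_word u \<and> reduced (c @ c)"
    using assms
  proof (induction w rule: length_induct)
    case (1 w)
    show ?case
    proof (cases "reduced (w @ w)")
      case True
      then show ?thesis by (intro exI[of _ "[]"] exI[of _ w]) simp
    next
      case False
      then have ne: "w \<noteq> []" and ends: "hd w = inv_letter (last w)"
        using 1 by (auto simp: reduced_append)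
      obtain x w' where x: "w = x # w'" using ne by (cases w) auto
      \<comment> \<open>No letter is its own inverse, so the cancelling end letters are two different ones.\<close>
      have "w' \<noteq> []"
        using ends x by (auto simp: inv_letter_def prod_eq_iff)
      then obtain v y where v: "w' = v @ [y]" by (meson rev_exhaust)
      have y: "y = inv_letter x" using ends x v by simp
      have "reduced v" using "1.prems" x v by (simp add: reduced_Cons reduced_append)
      then obtain u c where "v = u @ c @ inverse_word u" "reduced (c @ c)"
        using "1.IH"[rule_format, of v] x v by auto
      then show ?thesis
        using x v y by (intro exI[of _ "x # u"] exI[of _ c]) simp
    qed
  qed
  then show ?thesis using that by blast
qed

text \<open>
  If the two outer parts had different lengths, the core next to the shorter one would itself start
  with a letter and end with its inverse.
\<close>

lemma cyclically_reduced_core_unique: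
  assumes eq: "u @ p @ inverse_word u = v @ q @ inverse_word v"
    and p: "reduced (p @ p)" and q: "reduced (q @ q)"
  shows "p = q \<and> u = v"
proof -
  have not_shorter: "\<not> length u < length v"
    if eq: "u @ p @ inverse_word u = v @ q @ inverse_word v" and p: "reduced (p @ p)"
    for u v p q
  proof
    assume "length u < length v"
    moreover obtain s where s: "v = u @ s \<or> u = v @ s"
      using eq by (auto simp: append_eq_append_conv2)
    ultimately have v: "v = u @ s" and "s \<noteq> []" by auto
    then obtain x t where x: "s = x # t" by (cases s) auto
    have "p = s @ q @ inverse_word s" using eq v by simp
    then have "p = (x # t @ q @ inverse_word t) @ [inv_letter x]"
      using x by simp
    then have "hd p = inv_letter (last p)" "p \<noteq> []" by auto
    then show False using p by (simp add: reduced_append)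
  qed
  have "length u = length v"
    using not_shorter[OF eq p] not_shorter[OF eq[symmetric] q] by simp
  then show ?thesis using eq by simp
qed

lemma reduced_word_power:
  assumes "reduced (c @ c)"
  shows "reduced (word_power c k)"
proof (cases "c = []")
  case False
  have "reduced (word_power c k) \<and> (word_power c k = [] \<or> hd (word_power c k) = hd c)"
    using assms False by (induction k) (auto simp: reduced_append)
  then show ?thesis by simp
qed simp

lemma reduced_conjugate_word_power:
  assumes core: "reduced (c @ c)" and w: "reduced (u @ c @ inverse_word u)"
  shows "reduced (u @ word_power c (Suc k) @ inverse_word u)"
proof (cases "c = []")
  case False
  have "hd (word_power c (Suc k)) = hd c"
    using False by simp
  moreover have "last (word_power c (Suc k)) = last c"
    using False by (subst word_power_Suc_right) simp
  moreover have "reduced (word_power c (Suc k))"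
    using core by (rule reduced_word_power)
  moreover have "word_power c (Suc k) \<noteq> []"
    using False by simp
  ultimately show ?thesis
    using w False unfolding reduced_append[of u] reduced_append[of _ "inverse_word u"]
    by (simp only: hd_append2 append_is_Nil_conv simp_thms)
qed (use w in simp)

lemma free_group_pow_conjugate:
  assumes core: "reduced (c @ c)" and w: "u @ c @ inverse_word u \<in> carrier (free_group n)"
  shows "(u @ c @ inverse_word u) [^]\<^bsub>free_group n\<^esub> Suc k
    = u @ word_power c (Suc k) @ inverse_word u"
proof (induction k)
  case 0
  interpret F: group "free_group n" by (rule group_free_group)
  show ?case using w by simp
next
  case (Suc k)
  interpret F: group "free_group n" by (rule group_free_group)
  have red: "reduced (u @ c @ inverse_word u)" using w by (simp add: free_group_def)
  then have red_cu: "reduced (c @ inverse_word u)" and red_u: "reduced (inverse_word u)"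
    by (simp_all add: reduced_append)
  let ?P = "word_power c (Suc k)"
  have cu: "foldr push c (inverse_word u) = c @ inverse_word u"
    using reduce_append[OF red_u, of c] reduce_reduced[OF red_cu] by simp
  have ucu: "foldr push u (c @ inverse_word u) = u @ c @ inverse_word u"
    using reduce_append[OF red_cu, of u] reduce_reduced[OF red] by simp
  have "(u @ c @ inverse_word u) [^]\<^bsub>free_group n\<^esub> Suc (Suc k)
      = (u @ ?P @ inverse_word u) \<otimes>\<^bsub>free_group n\<^esub> (u @ c @ inverse_word u)"
    using Suc.IH by (simp only: F.nat_pow_Suc)
  also have "\<dots> = foldr push (u @ ?P @ inverse_word u) (u @ c @ inverse_word u)"
    using reduce_append[OF red, of "u @ ?P @ inverse_word u"]
    by (simp only: free_group_def monoid.simps)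
  also have "\<dots> = foldr push (u @ ?P) (foldr push (inverse_word u) (foldr push u (c @ inverse_word u)))"
    unfolding ucu by (simp only: foldr_append comp_apply)
  \<comment> \<open>The inner \<open>u\<inverse> u\<close> cancels, and what is left is already reduced.\<close>
  also have "\<dots> = foldr push (u @ ?P @ c) (inverse_word u)"
    unfolding foldr_push_inverse'[OF red_cu] by (simp only: cu foldr_append comp_apply)
  also have "\<dots> = reduce ((u @ ?P @ c) @ inverse_word u)"
    by (rule reduce_append[OF red_u, symmetric])
  also have "\<dots> = reduce (u @ word_power c (Suc (Suc k)) @ inverse_word u)"
    unfolding word_power_Suc_right[where k = "Suc k"] by (simp only: append_assoc)
  also have "\<dots> = u @ word_power c (Suc (Suc k)) @ inverse_word u"
    by (rule reduce_reduced[OF reduced_conjugate_word_power[OF core red]])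
  finally show ?case .
qed

lemma free_group_nat_pow_inj:
  assumes x: "x \<in> carrier (free_group n)" and y: "y \<in> carrier (free_group n)"
    and k: "k > 0" and eq: "x [^]\<^bsub>free_group n\<^esub> (k::nat) = y [^]\<^bsub>free_group n\<^esub> k"
  shows "x = y"
proof -
  obtain m where m: "k = Suc m" using k by (cases k) auto
  have "reduced x" "reduced y" using x y by (auto simp: free_group_def)
  then obtain u c v d where uc: "x = u @ c @ inverse_word u" "reduced (c @ c)"
    and vd: "y = v @ d @ inverse_word v" "reduced (d @ d)"
    by (meson cyclically_reduced_core)
  have "u @ word_power c k @ inverse_word u = v @ word_power d k @ inverse_word v"
    using eq x y free_group_pow_conjugate[OF uc(2)] free_group_pow_conjugate[OF vd(2)]
    unfolding uc(1) vd(1) m by metis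
  moreover have "reduced (word_power e k @ word_power e k)" if "reduced (e @ e)" for e
    using reduced_word_power[OF that, of "k + k"] by (simp add: replicate_add)
  ultimately have "word_power c k = word_power d k \<and> u = v"
    using uc(2) vd(2) by (intro cyclically_reduced_core_unique) auto
  then show ?thesis
    using word_power_inj[OF k] uc(1) vd(1) by blast
qed

lemma free_group_int_pow_inj:
  assumes x: "x \<in> carrier (free_group n)" and y: "y \<in> carrier (free_group n)"
    and k: "k \<noteq> 0" and eq: "x [^]\<^bsub>free_group n\<^esub> (k::int) = y [^]\<^bsub>free_group n\<^esub> k"
  shows "x = y"
proof -
  interpret F: group "free_group n" by (rule group_free_group)
  let ?m = "nat \<bar>k\<bar>"
  have "x [^]\<^bsub>free_group n\<^esub> int ?m = y [^]\<^bsub>free_group n\<^esub> int ?m"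
  proof (cases "k > 0")
    case True
    then have "int ?m = k" by simp
    then show ?thesis using eq by (simp only:)
  next
    case False
    then have m: "int ?m = - k" by simp
    show ?thesis
      unfolding m F.int_pow_neg[OF x] F.int_pow_neg[OF y] eq by (rule refl)
  qed
  then have "x [^]\<^bsub>free_group n\<^esub> ?m = y [^]\<^bsub>free_group n\<^esub> ?m"
    unfolding int_pow_int .
  moreover have "?m > 0" using k by simp
  ultimately show ?thesis
    using free_group_nat_pow_inj[OF x y] by blast
qed


section \<open>Automorphic images, powers and roots of achiral words\<close>

theorem corollary3:
  fixes n :: nat and w :: word
  assumes "w \<in> carrier (free_group n)"
  shows "(achiral TYPE(nat) n w \<longrightarrow>
            (\<forall>\<sigma> \<in> iso (free_group n) (free_group n). achiral TYPE('g) n (\<sigma> w))) \<and>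
         (achiral TYPE(nat) n w \<longrightarrow>
            (\<forall>k::int. achiral TYPE('g) n (w [^]\<^bsub>free_group n\<^esub> k))) \<and>
         ((\<exists>k::int. k \<noteq> 0 \<and> achiral TYPE(nat) n (w [^]\<^bsub>free_group n\<^esub> k)) \<longrightarrow>
            achiral TYPE('g) n w)"
proof (intro conjI impI ballI allI)
  let ?F = "free_group n"
  interpret F: group ?F by (rule group_free_group)
  note w = assms
  have pow: "\<phi> (w [^]\<^bsub>?F\<^esub> k) = \<phi> w [^]\<^bsub>?F\<^esub> k" if "\<phi> \<in> hom ?F ?F" for \<phi> and k :: int
    using hom_int_pow[OF that w] group_free_group by blast
  {
    fix \<sigma> assume ach: "achiral TYPE(nat) n w" and \<sigma>: "\<sigma> \<in> iso ?F ?F"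
    obtain \<phi> where \<phi>: "\<phi> \<in> hom ?F ?F" "\<phi> w = inv\<^bsub>?F\<^esub> w"
      using inverting_endomorphism_if_achiral[OF infinite_UNIV_nat w ach] by blast
    define \<tau> where "\<tau> = inv_into (carrier ?F) \<sigma>"
    have \<sigma>h: "\<sigma> \<in> hom ?F ?F" and inj: "inj_on \<sigma> (carrier ?F)"
      using \<sigma> by (auto simp: iso_def bij_betw_def)
    have \<tau>h: "\<tau> \<in> hom ?F ?F"
      using F.iso_set_sym[OF \<sigma>] by (simp add: \<tau>_def iso_def)
    have "\<sigma> \<circ> (\<phi> \<circ> \<tau>) \<in> hom ?F ?F"
      using \<sigma>h \<tau>h \<phi>(1) by (intro hom_compose)
    moreover have "(\<sigma> \<circ> (\<phi> \<circ> \<tau>)) (\<sigma> w) = inv\<^bsub>?F\<^esub> \<sigma> w"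
      using w inj \<phi>(2) hom_inv_free_group[OF \<sigma>h w] by (simp add: \<tau>_def)
    ultimately show "achiral TYPE('g) n (\<sigma> w)"
      by (rule achiral_if_inverting_endomorphism[OF hom_in_carrier[OF \<sigma>h w]])
  next
    fix k :: int assume ach: "achiral TYPE(nat) n w"
    obtain \<phi> where \<phi>: "\<phi> \<in> hom ?F ?F" "\<phi> w = inv\<^bsub>?F\<^esub> w"
      using inverting_endomorphism_if_achiral[OF infinite_UNIV_nat w ach] by blast
    have "\<phi> (w [^]\<^bsub>?F\<^esub> k) = inv\<^bsub>?F\<^esub> (w [^]\<^bsub>?F\<^esub> k)"
      using pow[OF \<phi>(1)] \<phi>(2) w by (simp add: F.int_pow_inv)
    then show "achiral TYPE('g) n (w [^]\<^bsub>?F\<^esub> k)"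
      using achiral_if_inverting_endomorphism[OF F.int_pow_closed[OF w] \<phi>(1)] by blast
  next
    assume "\<exists>k::int. k \<noteq> 0 \<and> achiral TYPE(nat) n (w [^]\<^bsub>?F\<^esub> k)"
    then obtain k :: int where k: "k \<noteq> 0" and ach: "achiral TYPE(nat) n (w [^]\<^bsub>?F\<^esub> k)"
      by blast
    obtain \<phi> where \<phi>: "\<phi> \<in> hom ?F ?F" "\<phi> (w [^]\<^bsub>?F\<^esub> k) = inv\<^bsub>?F\<^esub> (w [^]\<^bsub>?F\<^esub> k)"
      using inverting_endomorphism_if_achiral[OF infinite_UNIV_nat F.int_pow_closed[OF w] ach]
      by blast
    have "\<phi> w [^]\<^bsub>?F\<^esub> k = (inv\<^bsub>?F\<^esub> w) [^]\<^bsub>?F\<^esub> k"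
      using pow[OF \<phi>(1)] \<phi>(2) w by (simp add: F.int_pow_inv)
    then have "\<phi> w = inv\<^bsub>?F\<^esub> w"
      using free_group_int_pow_inj[OF hom_in_carrier[OF \<phi>(1) w] F.inv_closed[OF w] k] by blast
    then show "achiral TYPE('g) n w"
      using achiral_if_inverting_endomorphism[OF w \<phi>(1)] by blast
  }
qed

end
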